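(* Let $\mathcal{L} \subseteq \mathbb{S}^n$ be a linear subspace and $C, Y \in \mathbb{S}^n$. Let $\mathcal{G} \subset \mathbb{R}^{n\times n}$ be a finite group of orthogonal matrices that, for all $U \in \mathcal{G}$, satisfies $$UCU^T = C, \qquad \{UXU^T : X \in Y+\mathcal{L}\} \subseteq Y + \mathcal{L}.$$ Let $\mathcal{F}_{\mathcal{G}} := \{X \in \mathbb{S}^n : UXU^T = X \ \ \forall U \in \mathcal{G}\}$. Then the orthogonal projection $P_{\mathcal{F}_{\mathcal{G}}} : \mathbb{S}^n \to \mathbb{S}^n$ onto $\mathcal{F}_{\mathcal{G}}$ satisfies the Constraint Set Invariance Conditions for $(C,Y,\mathcal{L})$ and, in addition, the equality $P_{\mathcal{F}_{\mathcal{G}}}(C) = C$.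
   Context: $\mathbb{S}^n$ is the space of real symmetric $n\times n$ matrices with the trace inner product $X\cdot Y := \mathrm{Tr}(XY)$; $\mathbb{S}^n_+$ is the positive semidefinite cone; $P_{\mathcal{S}}$ denotes the orthogonal projection onto a subspace $\mathcal{S}$. Constraint Set Invariance Conditions: $P_{\mathcal{S}}$ satisfies them if (a) $P_{\mathcal{S}}(\mathbb{S}^n_+)\subseteq \mathbb{S}^n_+$; (b) $P_{\mathcal{S}}(Y+\mathcal{L})\subseteq Y+\mathcal{L}$; (c) $P_{\mathcal{S}}(C+\mathcal{L}^\perp)\subseteq C+\mathcal{L}^\perp$. *)

theory Defs
  imports "HOL-Analysis.Analysis" "HOL-Algebra.Group"
begin

definition symmetric_matrices :: "(real ^ 'n ^ 'n) set" where
  "symmetric_matrices = {X. transpose X = X}"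

definition psd_matrices :: "(real ^ 'n ^ 'n) set" where
  "psd_matrices = {X \<in> symmetric_matrices. \<forall>v. 0 \<le> v \<bullet> (X *v v)}"

definition trace_inner :: "real ^ 'n ^ 'n \<Rightarrow> real ^ 'n ^ 'n \<Rightarrow> real" where
  "trace_inner X Y = trace (X ** Y)"

lemma trace_inner_eq_inner:
  assumes "Y \<in> symmetric_matrices"
  shows "trace_inner X Y = X \<bullet> Y"
proof -
  have "Y $ j $ i = Y $ i $ j" for i j
  proof -
    have "transpose Y $ i $ j = Y $ i $ j"
      using assms by (simp add: symmetric_matrices_def)
    then show ?thesis
      by (simp add: transpose_def)
  qed
  then show ?thesis
    by (simp add: trace_inner_def trace_def matrix_matrix_mult_def inner_vec_def)
qed

text \<open>
  The complement is taken inside the space of symmetric matrices, not inside the space of all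
  square matrices as the library's \<open>orthogonal_comp\<close> would do.
\<close>

definition sym_orthogonal_comp :: "(real ^ 'n ^ 'n) set \<Rightarrow> (real ^ 'n ^ 'n) set" where
  "sym_orthogonal_comp L = {Z \<in> symmetric_matrices. \<forall>X \<in> L. trace_inner X Z = 0}"

text \<open>
  The projection is meant for a subspace \<open>S\<close> of the symmetric matrices; the lemma
  \<open>orth_proj_eq_iff\<close> shows that the description is then proper.
\<close>

definition orth_proj :: "(real ^ 'n ^ 'n) set \<Rightarrow> real ^ 'n ^ 'n \<Rightarrow> real ^ 'n ^ 'n" where
  "orth_proj S X = (THE Z. Z \<in> S \<and> (\<forall>W \<in> S. trace_inner (X - Z) W = 0))"

lemma orth_proj_eq_iff:
  assumes S: "subspace S" "S \<subseteq> symmetric_matrices"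
  shows "orth_proj S X = Z \<longleftrightarrow> Z \<in> S \<and> (\<forall>W \<in> S. trace_inner (X - Z) W = 0)"
proof -
  let ?P = "\<lambda>Z. Z \<in> S \<and> (\<forall>W \<in> S. trace_inner (X - Z) W = 0)"
  have inner: "trace_inner A W = A \<bullet> W" if "W \<in> S" for A W
    using S(2) that by (blast intro: trace_inner_eq_inner)
  obtain y z where yz: "y \<in> span S" "\<And>w. w \<in> span S \<Longrightarrow> orthogonal z w" "X = y + z"
    using orthogonal_subspace_decomp_exists by blast
  have sp: "span S = S"
    using S by simp
  have ex: "?P y"
  proof (intro conjI ballI)
    show "y \<in> S"
      using yz(1) unfolding sp .
    show "trace_inner (X - y) W = 0" if "W \<in> S" for W
      using yz(2)[unfolded sp, OF that] yz(3) by (simp add: inner[OF that] orthogonal_def)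
  qed
  have uniq: "A = B" if "?P A" "?P B" for A B
  proof -
    have D: "A - B \<in> S"
      using that S(1) by (blast intro: subspace_diff)
    have "trace_inner (X - A) (A - B) = 0" "trace_inner (X - B) (A - B) = 0"
      using that D by blast+
    then have "(X - A) \<bullet> (A - B) = 0" "(X - B) \<bullet> (A - B) = 0"
      by (simp_all only: inner[OF D])
    then have "(A - B) \<bullet> (A - B) = 0"
      unfolding inner_diff_left by linarith
    then show ?thesis
      by simp
  qed
  have "orth_proj S X = y"
    unfolding orth_proj_def using ex uniq by (intro the_equality) blast+
  then show ?thesis
    using ex uniq by blast
qed

definition constraint_set_invariance ::
    "(real ^ 'n ^ 'n \<Rightarrow> real ^ 'n ^ 'n) \<Rightarrow> real ^ 'n ^ 'n \<Rightarrow> real ^ 'n ^ 'n \<Rightarrow>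
      (real ^ 'n ^ 'n) set \<Rightarrow> bool" where
  "constraint_set_invariance P C Y L \<longleftrightarrow>
     P ` psd_matrices \<subseteq> psd_matrices \<and>
     P ` ((+) Y ` L) \<subseteq> (+) Y ` L \<and>
     P ` ((+) C ` sym_orthogonal_comp L) \<subseteq> (+) C ` sym_orthogonal_comp L"

definition orthogonal_group :: "(real ^ 'n ^ 'n) monoid" where
  "orthogonal_group =
     \<lparr>carrier = {U. orthogonal_matrix U}, monoid.mult = (**), one = mat 1\<rparr>"

lemma group_orthogonal_group: "group orthogonal_group"
proof (rule groupI)
  fix U :: "real ^ 'n ^ 'n"
  assume "U \<in> carrier orthogonal_group"
  then have "transpose U \<in> carrier orthogonal_group"
    "transpose U \<otimes>\<^bsub>orthogonal_group\<^esub> U = \<one>\<^bsub>orthogonal_group\<^esub>"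
    by (simp_all add: orthogonal_group_def orthogonal_matrix_def)
  then show "\<exists>V \<in> carrier orthogonal_group.
      V \<otimes>\<^bsub>orthogonal_group\<^esub> U = \<one>\<^bsub>orthogonal_group\<^esub>"
    by blast
qed (simp_all add: orthogonal_group_def orthogonal_matrix_mul orthogonal_matrix_id
    matrix_mul_assoc)

definition fixed_subspace :: "(real ^ 'n ^ 'n) set \<Rightarrow> (real ^ 'n ^ 'n) set" where
  "fixed_subspace G = {X \<in> symmetric_matrices. \<forall>U \<in> G. U ** X ** transpose U = X}"

lemma fixed_subspace_subset: "fixed_subspace G \<subseteq> symmetric_matrices"
  by (auto simp: fixed_subspace_def)

lemma subspace_fixed_subspace: "subspace (fixed_subspace (G :: (real ^ 'n ^ 'n) set))"
proof (rule subspaceI)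
  show "0 \<in> fixed_subspace G"
    by (simp add: fixed_subspace_def symmetric_matrices_def transpose_def vec_eq_iff
        matrix_matrix_mult_def)
next
  fix X Z :: "real ^ 'n ^ 'n"
  assume "X \<in> fixed_subspace G" "Z \<in> fixed_subspace G"
  moreover have "transpose (X + Z) = transpose X + transpose Z"
    by (simp add: transpose_def vec_eq_iff)
  moreover have "U ** (X + Z) ** transpose U = U ** X ** transpose U + U ** Z ** transpose U"
    for U :: "real ^ 'n ^ 'n"
    by (simp add: matrix_matrix_mult_def vec_eq_iff distrib_left distrib_right sum.distrib)
  ultimately show "X + Z \<in> fixed_subspace G"
    by (simp add: fixed_subspace_def symmetric_matrices_def)
next
  fix c :: real and X :: "real ^ 'n ^ 'n"
  assume "X \<in> fixed_subspace G"
  moreover have "U ** (c *\<^sub>R X) ** transpose U = c *\<^sub>R (U ** X ** transpose U)"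
    for U :: "real ^ 'n ^ 'n"
    by (metis matrix_scalar_ac scalar_matrix_assoc)
  ultimately show "c *\<^sub>R X \<in> fixed_subspace G"
    by (simp add: fixed_subspace_def symmetric_matrices_def transpose_scalar)
qed

end

theory Submission
  imports Defs
begin

text \<open>
  On symmetric matrices the projection onto \<open>fixed_subspace G\<close> is the group average
  \<open>X \<mapsto> (\<Sum>U\<in>G. U X U\<^sup>T) / |G|\<close>. Every term of the average preserves positive
  semidefiniteness, \<open>Y + L\<close> and, because \<open>G\<close> is closed under transposition and
  conjugation is adjoint to conjugation by the transpose, also \<open>C + L\<^sup>\<bottom>\<close>; these sets are
  convex, so the average preserves them too.
\<close>

definition mat_conj :: "real ^ 'n ^ 'n \<Rightarrow> real ^ 'n ^ 'n \<Rightarrow> real ^ 'n ^ 'n" where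
  "mat_conj U X = U ** X ** transpose U"

definition group_average :: "(real ^ 'n ^ 'n) set \<Rightarrow> real ^ 'n ^ 'n \<Rightarrow> real ^ 'n ^ 'n" where
  "group_average G X = (1 / card G) *\<^sub>R (\<Sum>U\<in>G. mat_conj U X)"

lemma linear_mat_conj: "linear (mat_conj U)"
proof (rule linearI)
  show "mat_conj U (X + Z) = mat_conj U X + mat_conj U Z" for X Z
    by (simp add: mat_conj_def matrix_matrix_mult_def vec_eq_iff distrib_left distrib_right
        sum.distrib)
  show "mat_conj U (c *\<^sub>R X) = c *\<^sub>R mat_conj U X" for c X
    by (simp add: mat_conj_def matrix_scalar_ac flip: scalar_matrix_assoc)
qed

lemma mat_conj_mult: "mat_conj (U ** V) X = mat_conj U (mat_conj V X)"
  by (simp add: mat_conj_def matrix_transpose_mul matrix_mul_assoc)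

lemma transpose_mat_conj: "transpose (mat_conj U X) = mat_conj U (transpose X)"
  by (simp add: mat_conj_def matrix_transpose_mul matrix_mul_assoc)

lemma mat_conj_symmetric: "X \<in> symmetric_matrices \<Longrightarrow> mat_conj U X \<in> symmetric_matrices"
  by (simp add: symmetric_matrices_def transpose_mat_conj)

text \<open>The quadratic form of \<open>mat_conj U X\<close> at \<open>v\<close> is that of
  \<open>X\<close> at \<open>transpose U *v v\<close>.\<close>

lemma mat_conj_psd:
  assumes "X \<in> psd_matrices"
  shows "mat_conj U X \<in> psd_matrices"
proof -
  have "0 \<le> v \<bullet> (mat_conj U X *v v)" for v
  proof -
    have "v \<bullet> (mat_conj U X *v v) = (transpose U *v v) \<bullet> (X *v (transpose U *v v))"
      by (simp add: mat_conj_def dot_lmul_matrix flip: matrix_vector_mul_assoc)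
    then show ?thesis
      using assms by (simp add: psd_matrices_def)
  qed
  then show ?thesis
    using assms by (simp add: psd_matrices_def mat_conj_symmetric)
qed

text \<open>Cyclicity of the trace carries the left factor \<open>U\<close> around to the right of
  \<open>W\<close>, so conjugation by \<open>transpose U\<close> is the adjoint of conjugation by
  \<open>U\<close>.\<close>

lemma trace_inner_mat_conj:
  "trace_inner (mat_conj U X) W = trace_inner X (mat_conj (transpose U) W)"
proof -
  have "trace (U ** (X ** transpose U ** W)) = trace ((X ** transpose U ** W) ** U)"
    by (rule trace_mul_sym)
  then show ?thesis
    by (simp add: trace_inner_def mat_conj_def matrix_mul_assoc)
qed

lemma subspace_symmetric_matrices: "subspace symmetric_matrices"
  by (auto intro!: subspaceI simp: symmetric_matrices_def transpose_def vec_eq_iff)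

lemma convex_psd_matrices: "convex psd_matrices"
proof (rule convexI)
  fix X Z :: "real ^ 'n ^ 'n" and u v :: real
  assume "X \<in> psd_matrices" "Z \<in> psd_matrices" "0 \<le> u" "0 \<le> v"
  then show "u *\<^sub>R X + v *\<^sub>R Z \<in> psd_matrices"
    by (simp add: psd_matrices_def matrix_vector_mult_add_rdistrib inner_add_right
        subspace_add[OF subspace_symmetric_matrices] subspace_scale[OF subspace_symmetric_matrices]
        flip: scaleR_matrix_vector_assoc)
qed

text \<open>The average is a convex combination with equal weights \<open>1 / card G\<close>. Each
  invariance claim for the average thus reduces to one for single conjugations.\<close>

lemma group_average_in_convex:
  assumes "finite G" "G \<noteq> {}" "convex S" "\<And>U. U \<in> G \<Longrightarrow> mat_conj U X \<in> S"
  shows "group_average G X \<in> S"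
proof -
  have "(\<Sum>U\<in>G. (1 / card G) *\<^sub>R mat_conj U X) \<in> S"
    using assms by (intro convex_sum) auto
  then show ?thesis
    by (simp add: group_average_def scaleR_right.sum)
qed

lemma linear_group_average: "linear (group_average G)"
  unfolding group_average_def
  by (intro linear_compose_scale_right linear_compose_sum ballI linear_mat_conj)

lemma group_average_fixed:
  assumes "finite G" "G \<noteq> {}" "\<And>U. U \<in> G \<Longrightarrow> mat_conj U X = X"
  shows "group_average G X = X"
  \<comment> \<open>The singleton \<open>{X}\<close> is convex and contains every term of the
    average.\<close>
  using group_average_in_convex[of G "{X}" X] assms by simp

lemma trace_inner_group_average:
  assumes "W \<in> symmetric_matrices"
  shows "trace_inner (group_average G X) W
    = (1 / card G) * (\<Sum>U\<in>G. trace_inner X (mat_conj (transpose U) W))"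
  using assms
  by (simp add: trace_inner_eq_inner group_average_def inner_sum_left
      flip: trace_inner_mat_conj)

text \<open>The inverse in \<open>orthogonal_group\<close> is the transpose, so closure under
  inverses becomes closure under transposition.\<close>

lemma subgroup_orthogonal_groupD:
  assumes "subgroup G orthogonal_group"
  shows "mat 1 \<in> G"
    and "U \<in> G \<Longrightarrow> orthogonal_matrix U"
    and "U \<in> G \<Longrightarrow> V \<in> G \<Longrightarrow> U ** V \<in> G"
    and "U \<in> G \<Longrightarrow> transpose U \<in> G"
proof -
  interpret subgroup G orthogonal_group by fact
  show "mat 1 \<in> G" "U \<in> G \<Longrightarrow> V \<in> G \<Longrightarrow> U ** V \<in> G"
    using one_closed m_closed by (simp_all add: orthogonal_group_def)
  show orth: "orthogonal_matrix U" if "U \<in> G" for U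
    using mem_carrier[OF that] by (simp add: orthogonal_group_def)
  show "transpose U \<in> G" if "U \<in> G"
  proof -
    have "inv\<^bsub>orthogonal_group\<^esub> U = transpose U"
      using orth[OF that]
      by (intro group.inv_equality[OF group_orthogonal_group])
        (simp_all add: orthogonal_group_def orthogonal_matrix_def)
    then show ?thesis
      using m_inv_closed[OF that] by simp
  qed
qed

text \<open>Left multiplication by \<open>V\<close> permutes \<open>G\<close>, so conjugating the
  average by \<open>V\<close> only reorders its terms.\<close>

lemma mat_conj_group_average:
  assumes G: "subgroup G orthogonal_group" and V: "V \<in> G"
  shows "mat_conj V (group_average G X) = group_average G X"
proof -
  note GD = subgroup_orthogonal_groupD[OF G]
  have V1: "transpose V ** V = mat 1" "V ** transpose V = mat 1"
    using GD(2)[OF V] by (simp_all add: orthogonal_matrix_def)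
  have "(\<Sum>U\<in>G. mat_conj (V ** U) X) = (\<Sum>U\<in>G. mat_conj U X)"
    by (rule sum.reindex_bij_witness[where j = "\<lambda>U. V ** U" and i = "\<lambda>U. transpose V ** U"])
      (simp_all add: matrix_mul_assoc V1 GD V)
  then show ?thesis
    by (simp add: group_average_def linear_cmul[OF linear_mat_conj] linear_sum[OF linear_mat_conj]
        mat_conj_mult)
qed

text \<open>By \<open>orth_proj_eq_iff\<close> two facts suffice: the average lies in the fixed
  subspace, and its difference from \<open>X\<close> is orthogonal to that subspace.\<close>

lemma orth_proj_fixed_subspace:
  assumes G: "subgroup G orthogonal_group" "finite G" and X: "X \<in> symmetric_matrices"
  shows "orth_proj (fixed_subspace G) X = group_average G X"
  unfolding orth_proj_eq_iff[OF subspace_fixed_subspace fixed_subspace_subset]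
proof (intro conjI ballI)
  note GD = subgroup_orthogonal_groupD[OF G(1)]
  have "group_average G X \<in> symmetric_matrices"
    using GD(1) G(2) X
    by (intro group_average_in_convex subspace_imp_convex subspace_symmetric_matrices
        mat_conj_symmetric) auto
  then show "group_average G X \<in> fixed_subspace G"
    using mat_conj_group_average[OF G(1)] by (simp add: fixed_subspace_def mat_conj_def)
  fix W assume W: "W \<in> fixed_subspace G"
  then have Wsym: "W \<in> symmetric_matrices"
    by (simp add: fixed_subspace_def)
  \<comment> \<open>Moved to the other side of the inner product, each conjugation fixes
    \<open>W\<close>, so all \<open>card G\<close> terms equal \<open>trace_inner X W\<close> and
    the factor \<open>1 / card G\<close> cancels.\<close>
  have "mat_conj (transpose U) W = W" if "U \<in> G" for U
    using W GD(4)[OF that] unfolding fixed_subspace_def mat_conj_def by blast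
  moreover have "card G \<noteq> 0"
    using GD(1) G(2) by auto
  ultimately have "trace_inner (group_average G X) W = trace_inner X W"
    by (simp add: trace_inner_group_average[OF Wsym])
  then show "trace_inner (X - group_average G X) W = 0"
    by (simp add: trace_inner_eq_inner[OF Wsym] inner_diff_left)
qed

text \<open>By linearity, \<open>mat_conj U A\<close> is the difference of the images of
  \<open>Y + A\<close> and \<open>Y\<close>; both images lie in \<open>Y + L\<close>, so their
  difference lies in \<open>L\<close>.\<close>

lemma mat_conj_direction_invariant:
  assumes L: "subspace L" and inv: "mat_conj U ` ((+) Y ` L) \<subseteq> (+) Y ` L" and A: "A \<in> L"
  shows "mat_conj U A \<in> L"
proof -
  obtain B where B: "B \<in> L" "mat_conj U (Y + A) = Y + B"
    using inv A by blast
  obtain D where D: "D \<in> L" "mat_conj U (Y + 0) = Y + D"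
    using inv subspace_0[OF L] by blast
  have "mat_conj U A = B - D"
    using B(2) D(2) by (simp add: linear_add[OF linear_mat_conj] algebra_simps)
  then show ?thesis
    using B(1) D(1) L by (simp add: subspace_diff)
qed

text \<open>Pairing the average of \<open>Z\<close> with \<open>A\<close> in \<open>L\<close>
  amounts to pairing \<open>Z\<close> with the conjugates of \<open>A\<close> by transposes. These
  are again elements of \<open>L\<close>, so every term vanishes.\<close>

lemma group_average_sym_orthogonal_comp:
  assumes G: "subgroup G orthogonal_group" "finite G" and L: "L \<subseteq> symmetric_matrices"
    and inv: "\<And>U A. U \<in> G \<Longrightarrow> A \<in> L \<Longrightarrow> mat_conj U A \<in> L"
    and Z: "Z \<in> sym_orthogonal_comp L"
  shows "group_average G Z \<in> sym_orthogonal_comp L"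
proof -
  note GD = subgroup_orthogonal_groupD[OF G(1)]
  have comm: "trace_inner A B = trace_inner B A" for A B :: "real ^ 'n ^ 'n"
    unfolding trace_inner_def by (rule trace_mul_sym)
  have "group_average G Z \<in> symmetric_matrices"
    using GD(1) G(2) Z
    by (intro group_average_in_convex subspace_imp_convex subspace_symmetric_matrices
        mat_conj_symmetric) (auto simp: sym_orthogonal_comp_def)
  moreover have "trace_inner A (group_average G Z) = 0" if "A \<in> L" for A
  proof -
    have "trace_inner Z (mat_conj (transpose U) A) = 0" if "U \<in> G" for U
      using Z inv[OF GD(4)[OF that] \<open>A \<in> L\<close>] by (simp add: sym_orthogonal_comp_def comm[of Z])
    then show ?thesis
      using L that by (subst comm) (simp add: trace_inner_group_average subset_iff)
  qed
  ultimately show ?thesis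
    by (simp add: sym_orthogonal_comp_def)
qed

theorem proposition2p4:
  fixes C Y :: "real ^ 'n ^ 'n" and L G :: "(real ^ 'n ^ 'n) set"
  assumes "subspace L" and "L \<subseteq> symmetric_matrices"
    and "C \<in> symmetric_matrices" and "Y \<in> symmetric_matrices"
    and "subgroup G orthogonal_group" and "finite G"
    and "\<And>U. U \<in> G \<Longrightarrow> U ** C ** transpose U = C"
    and "\<And>U. U \<in> G \<Longrightarrow> {U ** X ** transpose U | X. X \<in> (+) Y ` L} \<subseteq> (+) Y ` L"
  shows "constraint_set_invariance (orth_proj (fixed_subspace G)) C Y L
    \<and> orth_proj (fixed_subspace G) C = C"
proof -
  note proj = orth_proj_fixed_subspace[OF assms(5,6)]
  have ne: "G \<noteq> {}"
    using subgroup_orthogonal_groupD(1)[OF assms(5)] by blast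
  have sym_add: "A + B \<in> symmetric_matrices"
    if "A \<in> symmetric_matrices" "B \<in> symmetric_matrices" for A B :: "real ^ 'n ^ 'n"
    using that by (rule subspace_add[OF subspace_symmetric_matrices])
  have inv: "mat_conj U ` ((+) Y ` L) \<subseteq> (+) Y ` L" if "U \<in> G" for U
    using assms(8)[OF that] unfolding mat_conj_def by blast
  have avgC: "group_average G C = C"
    using assms(6,7) ne by (intro group_average_fixed) (simp_all add: mat_conj_def)
  have "orth_proj (fixed_subspace G) X \<in> psd_matrices" if X: "X \<in> psd_matrices" for X
  proof -
    have "group_average G X \<in> psd_matrices"
      using assms(6) ne X by (intro group_average_in_convex convex_psd_matrices mat_conj_psd)
    then show ?thesis
      using X by (simp add: proj psd_matrices_def)
  qed
  moreover have "orth_proj (fixed_subspace G) X \<in> (+) Y ` L" if X: "X \<in> (+) Y ` L" for X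
  proof -
    have "group_average G X \<in> (+) Y ` L"
      using assms(1,6) ne X inv
      by (intro group_average_in_convex convex_translation subspace_imp_convex) blast+
    moreover have "X \<in> symmetric_matrices"
      using X assms(2,4) sym_add by blast
    ultimately show ?thesis
      by (simp add: proj)
  qed
  moreover have "orth_proj (fixed_subspace G) (C + Z) \<in> (+) C ` sym_orthogonal_comp L"
    if Z: "Z \<in> sym_orthogonal_comp L" for Z
  proof -
    \<comment> \<open>Since averaging is linear and fixes \<open>C\<close>, the average of
      \<open>C + Z\<close> is \<open>C\<close> plus the average of \<open>Z\<close>, so only the
      latter has to be located.\<close>
    have "group_average G Z \<in> sym_orthogonal_comp L"
      using assms(1,2,5,6) inv Z
      by (intro group_average_sym_orthogonal_comp mat_conj_direction_invariant[where Y = Y])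
    moreover have "C + Z \<in> symmetric_matrices"
      using Z assms(3) sym_add by (simp add: sym_orthogonal_comp_def)
    ultimately show ?thesis
      by (simp add: proj linear_add[OF linear_group_average] avgC)
  qed
  ultimately show ?thesis
    using proj[OF assms(3)] avgC unfolding constraint_set_invariance_def by auto
qed

end
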